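(* For every positive integer $k$, every graph $G$ with degeneracy at least $12k$, and every tournament $T$ on the same vertex set as $G$, there exist vertices $x, y$ such that $G[N_T^+(\{x,y\})]$ has degeneracy at least $k-1$.
   Context: Graphs are finite and simple; a tournament is an orientation of a finite complete graph. The degeneracy of a graph is the maximum, over all its (non-empty) subgraphs, of the minimum degree of the subgraph. $G[S]$ denotes the subgraph of $G$ induced on a vertex set $S$. For a tournament $T$, $N_T^+(v)$ is the set of vertices $w$ such that $T$ has an arc from $v$ to $w$ (so $v \notin N_T^+(v)$), and for a vertex set $U$, $N_T^+(U) = \bigcup_{v \in U} N_T^+(v)$, which might contain vertices of $U$. *)

theory Defs
  imports "Graph_Theory.Digraph_Component"
begin

text \<open>
  Following the convention of the theory Digraph, a finite simple undirected graph is a finite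
  symmetric digraph without loops and parallel arcs (locale \<^locale>\<open>graph\<close>); an edge is
  a pair of opposite arcs, so the degree of a vertex is its \<^const>\<open>out_degree\<close>.
  The set of vertices may be empty.
\<close>

definition min_degree :: "('a, 'b) pre_digraph \<Rightarrow> nat" where
  "min_degree H = Min (out_degree H ` verts H)"

text \<open>
  The graph without vertices has no non-empty subgraph; its degeneracy is set to \<open>-1\<close>,
  below the degeneracy of every other graph.  The condition \<open>graph H\<close> is needed because
  \<^const>\<open>subgraph\<close> alone does not force a subdigraph of a symmetric digraph to be symmetric.
\<close>

definition degeneracy :: "('a, 'b) pre_digraph \<Rightarrow> int" where
  "degeneracy G =
     (if verts G = {} then - 1
      else Max {int (min_degree H) | H. subgraph H G \<and> graph H \<and> verts H \<noteq> {}})"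

locale tournament = digraph +
  assumes one_arc: "u \<in> verts G \<Longrightarrow> v \<in> verts G \<Longrightarrow> u \<noteq> v
    \<Longrightarrow> u \<rightarrow>\<^bsub>G\<^esub> v \<longleftrightarrow> \<not> v \<rightarrow>\<^bsub>G\<^esub> u"

definition out_neighbours :: "('a, 'b) pre_digraph \<Rightarrow> 'a \<Rightarrow> 'a set" where
  "out_neighbours T v = {w. v \<rightarrow>\<^bsub>T\<^esub> w}"

definition out_neighbourhood :: "('a, 'b) pre_digraph \<Rightarrow> 'a set \<Rightarrow> 'a set" where
  "out_neighbourhood T U = (\<Union>v\<in>U. out_neighbours T v)"

end

theory Submission
  imports Defs Complex_Main
begin

text \<open>
  A graph of degeneracy at least \<open>12 k\<close> has a non-empty vertex set \<open>V\<close> inside which every degree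
  is at least \<open>12 k\<close>; so at least \<open>12 k \<bar>V\<bar>\<close> arcs run inside \<open>V\<close>, each edge being counted
  twice.  It suffices to find \<open>x, y \<in> V\<close> whose out-neighbourhoods contain both ends of a fixed
  proportion of these arcs: the subgraph spanned by the out-neighbourhoods then has large average
  degree, hence a subgraph of large minimum degree.

  Such \<open>x\<close> and \<open>y\<close> are found by random choice.  By the minimax theorem a tournament has a
  probability distribution on its vertices such that each vertex is in the closed
  out-neighbourhood of a random vertex with probability at least \<open>1/2\<close>.  Two independent random
  vertices then both miss a given vertex with probability at most \<open>1/4\<close>, so the union of their
  closed out-neighbourhoods contains both ends of a given arc with probability at least \<open>1/2\<close>.
  One random vertex would not do: it might almost never catch both ends at once.

  A weaker distribution is enough, and the multiplicative weights method gives one by elementary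
  means.  Under any positive vertex weights some closed out-neighbourhood carries at least half of
  the total weight (\<open>half_weight_out_neighbourhood\<close>).  Choosing such a vertex and halving the
  weights in its closed out-neighbourhood, again and again, gives a sequence in which no vertex can
  have been reached too rarely, as its weight would exceed the total
  (\<open>sequence_by_weight_halving\<close>, \<open>balanced_sequence\<close>): every vertex is missed by at most \<open>3/5\<close>
  of the sequence.  Two random members of the sequence both miss a given vertex with probability at
  most \<open>9/25\<close>, so they catch both ends of an arc with probability at least \<open>1 - 18/25 = 7/25\<close>
  (\<open>pair_covering_many_arcs\<close>).  As \<open>7/25 \<cdot> 12 k > 2 k\<close>, deleting vertices of degree at most \<open>k\<close>
  leaves a subgraph of minimum degree greater than \<open>k\<close> (\<open>dense_imp_core\<close>).  The vertices \<open>x\<close> and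
  \<open>y\<close> belong to their closed but perhaps not to their open out-neighbourhoods; removing them costs
  each remaining vertex at most two neighbours (\<open>core_delete_two\<close>), which leaves minimum degree at
  least \<open>k - 1\<close>.
\<close>

section \<open>Almost optimal strategies in a tournament\<close>

text \<open>
  If \<open>x\<close> is drawn with probability proportional to its own weight, the expected weight of its
  closed out-neighbourhood is at least half of the total: of the two terms \<open>w u * w v\<close> belonging to
  a pair of vertices, \<open>D\<close> selects at least one.  Here and below, \<open>D\<close> is the arc relation of a
  tournament together with the identity, so that \<open>D `` {x}\<close> is a closed out-neighbourhood.
\<close>

lemma half_weight_out_neighbourhood:
  fixes w :: "'a \<Rightarrow> real"
  assumes "finite V" "V \<noteq> {}" and w: "\<And>v. v \<in> V \<Longrightarrow> 0 < w v"
    and D: "\<And>u v. u \<in> V \<Longrightarrow> v \<in> V \<Longrightarrow> (u, v) \<in> D \<or> (v, u) \<in> D"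
  shows "\<exists>x\<in>V. sum w V \<le> 2 * sum w (V \<inter> D `` {x})"
proof (rule ccontr)
  assume "\<not> ?thesis"
  then have small: "2 * sum w (V \<inter> D `` {x}) < sum w V" if "x \<in> V" for x
    using that by force
  define S where "S = (\<Sum>x\<in>V. \<Sum>y\<in>V. w x * w y * of_bool ((x, y) \<in> D))"
  have S: "S = (\<Sum>x\<in>V. w x * sum w (V \<inter> D `` {x}))"
  proof -
    have "sum w (V \<inter> D `` {x}) = (\<Sum>y\<in>V. w y * of_bool ((x, y) \<in> D))" for x
      unfolding sum.inter_restrict[OF \<open>finite V\<close>] by (intro sum.cong) auto
    then show ?thesis
      by (simp add: S_def sum_distrib_left mult.assoc)
  qed
  have "S = (\<Sum>x\<in>V. \<Sum>y\<in>V. w x * w y * of_bool ((y, x) \<in> D))"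
    unfolding S_def by (subst sum.swap) (simp add: mult.commute)
  then have "2 * S = (\<Sum>x\<in>V. \<Sum>y\<in>V. w x * w y * (of_bool ((x, y) \<in> D) + of_bool ((y, x) \<in> D)))"
    unfolding S_def by (simp add: algebra_simps sum.distrib)
  also have "\<dots> \<ge> (\<Sum>x\<in>V. \<Sum>y\<in>V. w x * w y)"
  proof (intro sum_mono)
    fix x y assume "x \<in> V" "y \<in> V"
    then have "0 \<le> w x * w y" "(x, y) \<in> D \<or> (y, x) \<in> D"
      using w D by (auto simp: less_imp_le)
    then show "w x * w y \<le> w x * w y * (of_bool ((x, y) \<in> D) + of_bool ((y, x) \<in> D))"
      by (auto simp: algebra_simps)
  qed
  finally have "sum w V * sum w V \<le> 2 * S"
    by (simp add: sum_product)
  moreover have "(\<Sum>x\<in>V. w x * (2 * sum w (V \<inter> D `` {x}))) < (\<Sum>x\<in>V. w x * sum w V)"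
    using assms small by (intro sum_strict_mono mult_strict_left_mono) auto
  moreover have "(\<Sum>x\<in>V. w x * (2 * sum w (V \<inter> D `` {x}))) = 2 * S"
    unfolding S by (subst sum_distrib_left) (simp add: mult.left_commute)
  ultimately show False
    by (simp flip: sum_distrib_right)
qed

text \<open>
  Let a vertex lose half of its weight each time it is reached.  If each new member of the sequence
  reaches at least half of the current weight, the total shrinks by a factor of \<open>3/4\<close> per step.
\<close>

lemma sequence_by_weight_halving:
  assumes "finite V" "V \<noteq> {}"
    and D: "\<And>u v. u \<in> V \<Longrightarrow> v \<in> V \<Longrightarrow> (u, v) \<in> D \<or> (v, u) \<in> D"
  shows "\<exists>f. (\<forall>i<m. f i \<in> V) \<and>
    (\<Sum>v\<in>V. (1/2 :: real) ^ card {i. i < m \<and> (f i, v) \<in> D}) \<le> card V * (3/4) ^ m"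
proof (induction m)
  case 0
  then show ?case by simp
next
  case (Suc m)
  then obtain f where f: "\<forall>i<m. f i \<in> V"
    and le: "(\<Sum>v\<in>V. (1/2 :: real) ^ card {i. i < m \<and> (f i, v) \<in> D}) \<le> card V * (3/4) ^ m"
    by blast
  define w where "w v = (1/2 :: real) ^ card {i. i < m \<and> (f i, v) \<in> D}" for v
  obtain x where x: "x \<in> V" "sum w V \<le> 2 * sum w (V \<inter> D `` {x})"
    using half_weight_out_neighbourhood[OF assms(1,2) _ D, of w] by (auto simp: w_def)
  define g where "g = f(m := x)"
  have step: "(1/2 :: real) ^ card {i. i < Suc m \<and> (g i, v) \<in> D}
      = w v - (if v \<in> D `` {x} then w v / 2 else 0)" for v
  proof -
    have "{i. i < Suc m \<and> (g i, v) \<in> D}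
        = (if (x, v) \<in> D then insert m {i. i < m \<and> (f i, v) \<in> D} else {i. i < m \<and> (f i, v) \<in> D})"
      by (auto simp: g_def less_Suc_eq)
    then show ?thesis by (simp add: w_def)
  qed
  have "(\<Sum>v\<in>V. (1/2 :: real) ^ card {i. i < Suc m \<and> (g i, v) \<in> D})
      = sum w V - sum w (V \<inter> D `` {x}) / 2"
    unfolding step sum_subtractf
    by (simp only: sum.inter_restrict[OF \<open>finite V\<close>, symmetric] sum_divide_distrib)
  also have "\<dots> \<le> 3/4 * sum w V"
    using x by simp
  also have "\<dots> \<le> card V * (3/4) ^ Suc m"
    using le by (simp add: w_def)
  finally show ?case
    using f x by (intro exI[of _ g]) (auto simp: g_def less_Suc_eq)
qed

text \<open>
  After \<open>m = 5 s\<close> halving steps, a vertex reached fewer than \<open>2 s\<close> times would have weight at least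
  \<open>(1/4) ^ s\<close>, but the total weight is at most \<open>\<bar>V\<bar> (3/4) ^ (5 s) = \<bar>V\<bar> (243/1024) ^ s\<close>, which is
  smaller for large \<open>s\<close>, since \<open>243/1024 < 1/4\<close>.
\<close>

lemma balanced_sequence:
  assumes "finite V" "V \<noteq> {}"
    and D: "\<And>u v. u \<in> V \<Longrightarrow> v \<in> V \<Longrightarrow> (u, v) \<in> D \<or> (v, u) \<in> D"
  shows "\<exists>s f. 0 < s \<and> (\<forall>i<5 * s. f i \<in> V) \<and>
    (\<forall>v\<in>V. card {i. i < 5 * s \<and> (f i, v) \<notin> D} \<le> 3 * s)"
proof -
  \<comment> \<open>\<open>q\<close> is the ratio of \<open>243/1024\<close> to \<open>1/4\<close>.\<close>
  define q :: real where "q = 972 / 1024"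
  have "0 < card V" using assms by (simp add: card_gt_0_iff)
  have "\<exists>s. q ^ s < 1 / card V"
    using \<open>0 < card V\<close> by (intro real_arch_pow_inv) (auto simp: q_def)
  then obtain s where s: "card V * q ^ s < 1"
    using \<open>0 < card V\<close> by (auto simp: field_simps)
  then have "0 < s"
    using \<open>0 < card V\<close> by (cases s) auto
  obtain f where f: "\<forall>i<5 * s. f i \<in> V"
    and le: "(\<Sum>v\<in>V. (1/2 :: real) ^ card {i. i < 5 * s \<and> (f i, v) \<in> D}) \<le> card V * (3/4) ^ (5 * s)"
    using sequence_by_weight_halving[OF assms, of "5 * s"] by blast
  have "card {i. i < 5 * s \<and> (f i, v) \<notin> D} \<le> 3 * s" if "v \<in> V" for v
  proof -
    define h where "h = card {i. i < 5 * s \<and> (f i, v) \<in> D}"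
    have "2 * s \<le> h"
    proof (rule ccontr)
      assume "\<not> 2 * s \<le> h"
      then have "(1/2 :: real) ^ (2 * s) \<le> (1/2) ^ h"
        by (intro power_decreasing) auto
      also have "\<dots> \<le> (\<Sum>v\<in>V. (1/2 :: real) ^ card {i. i < 5 * s \<and> (f i, v) \<in> D})"
        unfolding h_def by (rule member_le_sum) (use that assms in auto)
      finally have "(1/2 :: real) ^ (2 * s) \<le> card V * (3/4) ^ (5 * s)"
        using le by linarith
      then have "4 ^ s * (1/4 :: real) ^ s \<le> 4 ^ s * (card V * (243/1024) ^ s)"
        by (intro mult_left_mono) (simp_all add: power_mult, simp_all add: power_divide)
      also have "\<dots> = card V * q ^ s"
        by (simp add: q_def flip: power_mult_distrib)
      finally show False
        using s by (simp flip: power_mult_distrib)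
    qed
    moreover have "card {i. i < 5 * s \<and> (f i, v) \<in> D} + card {i. i < 5 * s \<and> (f i, v) \<notin> D} = 5 * s"
      by (subst card_Un_disjoint[symmetric]) (auto intro: arg_cong[of _ "{..<5 * s}" card, simplified])
    ultimately show ?thesis
      by (simp add: h_def)
  qed
  then show ?thesis
    using f \<open>0 < s\<close> by blast
qed

section \<open>Two out-neighbourhoods containing many arcs\<close>

text \<open>
  Among the \<open>25 s\<^sup>2\<close> pairs of positions in a balanced sequence, at most \<open>9 s\<^sup>2\<close> miss the first end of
  a given arc and at most \<open>9 s\<^sup>2\<close> miss the second, so at least \<open>7 s\<^sup>2\<close> catch both.  Double counting
  turns this into one pair that catches \<open>7/25\<close> of all arcs.
\<close>

lemma pair_covering_many_arcs:
  assumes "finite V" "V \<noteq> {}" and P: "P \<subseteq> V \<times> V"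
    and D: "\<And>u v. u \<in> V \<Longrightarrow> v \<in> V \<Longrightarrow> (u, v) \<in> D \<or> (v, u) \<in> D"
  shows "\<exists>x\<in>V. \<exists>y\<in>V. 7 * card P \<le> 25 * card (P \<inter> (D `` {x, y}) \<times> (D `` {x, y}))"
proof -
  obtain s f where "0 < s" and f: "\<forall>i<5 * s. f i \<in> V"
    and miss: "\<forall>v\<in>V. card {i. i < 5 * s \<and> (f i, v) \<notin> D} \<le> 3 * s"
    using balanced_sequence[OF assms(1,2) D] by blast
  define I where "I = {..<5 * s} \<times> {..<5 * s}"
  define N where "N = (\<lambda>(i, j). D `` {f i, f j})"
  have "finite P" using P assms(1) by (meson finite_SigmaI finite_subset)
  have missed: "card {p \<in> I. v \<notin> N p} \<le> 9 * s\<^sup>2" if "v \<in> V" for v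
  proof -
    have "{p \<in> I. v \<notin> N p} = {i. i < 5 * s \<and> (f i, v) \<notin> D} \<times> {i. i < 5 * s \<and> (f i, v) \<notin> D}"
      by (auto simp: I_def N_def)
    then have "card {p \<in> I. v \<notin> N p} \<le> (3 * s) * (3 * s)"
      using miss that by (simp only: card_cartesian_product mult_le_mono)
    then show ?thesis by (simp add: power2_eq_square)
  qed
  have covered: "7 * s\<^sup>2 \<le> card {p \<in> I. a \<in> N p \<times> N p}" if "a \<in> P" for a
  proof -
    obtain u v where a: "a = (u, v)" "u \<in> V" "v \<in> V" using \<open>a \<in> P\<close> P by auto
    have "{p \<in> I. a \<in> N p \<times> N p} \<union> ({p \<in> I. u \<notin> N p} \<union> {p \<in> I. v \<notin> N p}) = I"
      by (auto simp: a)
    from card_Un_le[of "{p \<in> I. a \<in> N p \<times> N p}" "{p \<in> I. u \<notin> N p} \<union> {p \<in> I. v \<notin> N p}", unfolded this]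
    have "card I \<le> card {p \<in> I. a \<in> N p \<times> N p} + card ({p \<in> I. u \<notin> N p} \<union> {p \<in> I. v \<notin> N p})" .
    moreover have "card ({p \<in> I. u \<notin> N p} \<union> {p \<in> I. v \<notin> N p}) \<le> 9 * s\<^sup>2 + 9 * s\<^sup>2"
      using missed[of u] missed[of v] a by (meson add_mono card_Un_le le_trans)
    moreover have "card I = 25 * s\<^sup>2"
      by (simp add: I_def card_cartesian_product power2_eq_square)
    ultimately show ?thesis by linarith
  qed
  have fin: "finite I" by (simp add: I_def)
  have "(0, 0) \<in> I" using \<open>0 < s\<close> by (simp add: I_def)
  have "\<exists>p\<in>I. 7 * card P \<le> 25 * card (P \<inter> N p \<times> N p)"
  proof (rule ccontr)
    assume "\<not> ?thesis"
    then have less: "25 * card (P \<inter> N p \<times> N p) < 7 * card P" if "p \<in> I" for p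
      using that by force
    have "25 * (\<Sum>p\<in>I. card (P \<inter> N p \<times> N p)) < (\<Sum>p\<in>I. 7 * card P)"
      unfolding sum_distrib_left
      by (rule sum_strict_mono) (use less fin \<open>(0, 0) \<in> I\<close> in auto)
    also have "\<dots> = 25 * (\<Sum>a\<in>P. 7 * s\<^sup>2)"
      by (simp add: I_def card_cartesian_product power2_eq_square)
    also have "\<dots> \<le> 25 * (\<Sum>a\<in>P. card {p \<in> I. a \<in> N p \<times> N p})"
      using covered by (intro mult_left_mono sum_mono) auto
    also have "(\<Sum>a\<in>P. card {p \<in> I. a \<in> N p \<times> N p}) = (\<Sum>p\<in>I. card {a \<in> P. a \<in> N p \<times> N p})"
      using \<open>finite P\<close> fin by (intro sum_multicount_gen) auto
    finally show False
      by (simp add: Int_def)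
  qed
  then show ?thesis
    using f by (auto simp: I_def N_def)
qed

section \<open>Subgraphs of large minimum degree\<close>

text \<open>
  Deleting a vertex of degree at most \<open>c\<close> destroys at most \<open>2 c\<close> arcs, so the assumed inequality
  persists and the deletion process stops before the vertices run out.
\<close>

lemma dense_imp_core:
  assumes "finite S" "sym E" "2 * c * card S < card (E \<inter> S \<times> S)"
  shows "\<exists>W\<subseteq>S. W \<noteq> {} \<and> (\<forall>u\<in>W. c < card (W \<inter> E `` {u}))"
  using assms(1,3)
proof (induction "card S" arbitrary: S)
  case 0
  then show ?case by simp
next
  case (Suc n)
  show ?case
  proof (cases "\<forall>u\<in>S. c < card (S \<inter> E `` {u})")
    case True
    then show ?thesis using Suc.hyps(2) by (intro exI[of _ S]) auto
  next
    case False
    then obtain u where u: "u \<in> S" "card (S \<inter> E `` {u}) \<le> c" by force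
    let ?A = "S \<inter> E `` {u}"
    have fin: "finite ?A" using \<open>finite S\<close> by simp
    have "E \<inter> S \<times> S \<subseteq> (E \<inter> (S - {u}) \<times> (S - {u})) \<union> (Pair u ` ?A \<union> (\<lambda>v. (v, u)) ` ?A)"
      using \<open>sym E\<close> by (auto dest: symD)
    then have "card (E \<inter> S \<times> S)
        \<le> card ((E \<inter> (S - {u}) \<times> (S - {u})) \<union> (Pair u ` ?A \<union> (\<lambda>v. (v, u)) ` ?A))"
      using Suc.prems(1) by (intro card_mono) auto
    also have "\<dots> \<le> card (E \<inter> (S - {u}) \<times> (S - {u})) + (card (Pair u ` ?A) + card ((\<lambda>v. (v, u)) ` ?A))"
      by (meson add_left_mono card_Un_le le_trans)
    also have "\<dots> \<le> card (E \<inter> (S - {u}) \<times> (S - {u})) + (c + c)"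
      using u(2) fin by (meson add_left_mono add_mono card_image_le le_trans)
    finally have "2 * c * card S < card (E \<inter> (S - {u}) \<times> (S - {u})) + (c + c)"
      using Suc.prems(2) by linarith
    moreover have card_S: "card S = Suc (card (S - {u}))"
      using u Suc.prems(1) by (intro card.remove)
    ultimately have "2 * c * card (S - {u}) < card (E \<inter> (S - {u}) \<times> (S - {u}))"
      by simp
    then have "\<exists>W\<subseteq>S - {u}. W \<noteq> {} \<and> (\<forall>v\<in>W. c < card (W \<inter> E `` {v}))"
      using Suc.hyps(2) Suc.prems(1) card_S by (intro Suc.hyps(1)) auto
    then show ?thesis by blast
  qed
qed

text \<open>
  A loopless graph of minimum degree greater than \<open>k \<ge> 1\<close> has at least three vertices, so that
  something remains when two are removed.
\<close>

lemma core_delete_two: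
  assumes W: "finite W" "W \<noteq> {}" "\<And>u. u \<in> W \<Longrightarrow> k < card (W \<inter> E `` {u})"
    and "irrefl E" "1 \<le> k"
  shows "W - {x, y} \<noteq> {} \<and> (\<forall>u\<in>W - {x, y}. k - 1 \<le> card ((W - {x, y}) \<inter> E `` {u}))"
proof -
  have drop: "card A \<le> card (A - {x, y}) + 2" for A :: "'a set"
    using diff_card_le_card_Diff[of "{x, y}" A] card_insert_le_m1[of 2 "{y}" x] by simp
  obtain v where "v \<in> W" using W by blast
  have "W \<inter> E `` {v} \<subseteq> W - {v}"
    using \<open>irrefl E\<close> by (auto simp: irrefl_def)
  then have "card (W \<inter> E `` {v}) \<le> card (W - {v})"
    using W by (intro card_mono) auto
  then have "2 < card W"
    using W(3)[OF \<open>v \<in> W\<close>] \<open>1 \<le> k\<close> card.remove[OF W(1) \<open>v \<in> W\<close>] by linarith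
  then have "card (W - {x, y}) \<noteq> 0"
    using drop[of W] by linarith
  then have "W - {x, y} \<noteq> {}"
    by (metis card.empty)
  moreover have "k - 1 \<le> card ((W - {x, y}) \<inter> E `` {u})" if "u \<in> W - {x, y}" for u
  proof -
    have "(W - {x, y}) \<inter> E `` {u} = W \<inter> E `` {u} - {x, y}" by auto
    then show ?thesis
      using drop[of "W \<inter> E `` {u}"] W(3)[of u] that by simp
  qed
  ultimately show ?thesis by blast
qed

section \<open>Degeneracy in terms of vertex sets\<close>

lemma (in digraph) out_degree_induce:
  assumes "u \<in> W"
  shows "out_degree (G \<restriction> W) u = card (W \<inter> arcs_ends G `` {u})"
proof -
  have "bij_betw (head G) (out_arcs (G \<restriction> W) u) (W \<inter> arcs_ends G `` {u})"
    unfolding bij_betw_def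
  proof
    show "inj_on (head G) (out_arcs (G \<restriction> W) u)"
      by (auto intro!: inj_onI no_multi_arcs simp: arc_to_ends_def)
    show "head G ` out_arcs (G \<restriction> W) u = W \<inter> arcs_ends G `` {u}"
      using assms by (auto simp: arcs_ends_conv image_iff)
  qed
  then show ?thesis
    by (simp add: out_degree_def bij_betw_same_card)
qed

lemma (in graph) graph_induce:
  assumes "W \<subseteq> verts G"
  shows "graph (G \<restriction> W)"
proof -
  have "induced_subgraph (G \<restriction> W) G" using assms by (rule induced_induce)
  then interpret H: digraph "G \<restriction> W" 
    using digraphI_induced by blast
  show ?thesis
    using \<open>induced_subgraph (G \<restriction> W) G\<close> induced_graph_imp_symmetric sym_arcs by blast
qed

text \<open>
  Passing from a subgraph to the subgraph induced on its vertices can only raise degrees, so that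
  induced subgraphs suffice to determine the degeneracy.  This reduces the theorem to statements
  about the relation \<^term>\<open>arcs_ends G\<close>.
\<close>

lemma (in graph) le_degeneracy_iff:
  "int d \<le> degeneracy G \<longleftrightarrow>
    (\<exists>W\<subseteq>verts G. W \<noteq> {} \<and> (\<forall>u\<in>W. d \<le> card (W \<inter> arcs_ends G `` {u})))"
proof (cases "verts G = {}")
  case True
  then show ?thesis by (auto simp: degeneracy_def)
next
  case False
  let ?D = "{int (min_degree H) | H. subgraph H G \<and> graph H \<and> verts H \<noteq> {}}"
  have min_in: "min_degree H \<in> out_degree H ` verts H"
    and min_le: "\<And>u. u \<in> verts H \<Longrightarrow> min_degree H \<le> out_degree H u"
    if "subgraph H G" "verts H \<noteq> {}" for H
  proof -
    have "finite (verts H)"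
      using that finite_subset[OF _ finite_verts] by (auto simp: subgraph_def)
    then show "min_degree H \<in> out_degree H ` verts H"
      "\<And>u. u \<in> verts H \<Longrightarrow> min_degree H \<le> out_degree H u"
      using that by (auto simp: min_degree_def intro!: Min_in)
  qed
  have degree_le: "out_degree H u \<le> card (verts H \<inter> arcs_ends G `` {u})"
    if "subgraph H G" "u \<in> verts H" for H u
  proof -
    have "out_arcs H u \<subseteq> out_arcs (G \<restriction> verts H) u"
      using subgraph_induce_subgraphI2[OF that(1)] by (auto simp: subgraph_def compatible_def)
    moreover have "finite (out_arcs (G \<restriction> verts H) u)"
      by (simp add: out_arcs_def)
    ultimately have "out_degree H u \<le> out_degree (G \<restriction> verts H) u"
      by (simp add: out_degree_def card_mono)
    then show ?thesis using that by (simp add: out_degree_induce)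
  qed
  \<comment> \<open>A \<open>Max\<close> is meaningful only over a finite set.\<close>
  have "?D \<subseteq> {0..int (card (verts G))}"
  proof
    fix z assume "z \<in> ?D"
    then obtain H where H: "z = int (min_degree H)" "subgraph H G" "verts H \<noteq> {}" by auto
    then obtain u where u: "u \<in> verts H" "min_degree H = out_degree H u"
      using min_in[of H] by auto
    have "card (verts H \<inter> arcs_ends G `` {u}) \<le> card (verts G)"
      using H by (intro card_mono) (auto simp: subgraph_def)
    then show "z \<in> {0..int (card (verts G))}"
      using degree_le[of H u] H u by simp
  qed
  then have fin: "finite ?D" using finite_subset by blast
  have graph_G: "graph G" by unfold_locales
  have "subgraph G G" by (rule subgraph_refl)
  with False graph_G have ne: "?D \<noteq> {}" by blast
  have "int d \<le> degeneracy G \<longleftrightarrow> (\<exists>z\<in>?D. int d \<le> z)"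
    using False Max_ge_iff[OF fin ne] by (simp add: degeneracy_def)
  also have "\<dots> \<longleftrightarrow> (\<exists>H. subgraph H G \<and> graph H \<and> verts H \<noteq> {} \<and> d \<le> min_degree H)"
    by (simp only: mem_Collect_eq bex_simps) (metis of_nat_le_iff)
  also have "\<dots> \<longleftrightarrow> (\<exists>W\<subseteq>verts G. W \<noteq> {} \<and> (\<forall>u\<in>W. d \<le> card (W \<inter> arcs_ends G `` {u})))"
  proof
    assume "\<exists>H. subgraph H G \<and> graph H \<and> verts H \<noteq> {} \<and> d \<le> min_degree H"
    then obtain H where H: "subgraph H G" "verts H \<noteq> {}" "d \<le> min_degree H" by blast
    have "d \<le> card (verts H \<inter> arcs_ends G `` {u})" if "u \<in> verts H" for u
      using H min_le[of H u] degree_le[of H u] that by linarith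
    then show "\<exists>W\<subseteq>verts G. W \<noteq> {} \<and> (\<forall>u\<in>W. d \<le> card (W \<inter> arcs_ends G `` {u}))"
      using H by (intro exI[of _ "verts H"]) (auto simp: subgraph_def)
  next
    assume "\<exists>W\<subseteq>verts G. W \<noteq> {} \<and> (\<forall>u\<in>W. d \<le> card (W \<inter> arcs_ends G `` {u}))"
    then obtain W where W: "W \<subseteq> verts G" "W \<noteq> {}"
      "\<forall>u\<in>W. d \<le> card (W \<inter> arcs_ends G `` {u})" by blast
    have sub: "subgraph (G \<restriction> W) G" using W(1) by (rule subgraph_induce_subgraphI)
    have "d \<le> min_degree (G \<restriction> W)"
      using min_in[OF sub] W by (auto simp: out_degree_induce)
    then show "\<exists>H. subgraph H G \<and> graph H \<and> verts H \<noteq> {} \<and> d \<le> min_degree H"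
      using sub W graph_induce[OF W(1)] by (intro exI[of _ "G \<restriction> W"]) auto
  qed
  finally show ?thesis .
qed

section \<open>The theorem\<close>

theorem theorem6:
  fixes k :: nat
    and G :: "('a, 'b) pre_digraph"
    and T :: "('a, 'c) pre_digraph"
  assumes "k \<ge> 1"
    and "graph G"
    and "degeneracy G \<ge> 12 * int k"
    and "tournament T"
    and "verts T = verts G"
  shows "\<exists>x\<in>verts G. \<exists>y\<in>verts G.
    degeneracy (G \<restriction> out_neighbourhood T {x, y}) \<ge> int k - 1"
proof -
  interpret G: graph G by fact
  interpret T: tournament T by fact
  let ?E = "arcs_ends G"
  define D where "D = arcs_ends T \<union> Id"
  have "int (12 * k) \<le> degeneracy G" using assms(3) by simp
  then obtain V where V: "V \<subseteq> verts G" "V \<noteq> {}"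
    and deg: "\<And>u. u \<in> V \<Longrightarrow> 12 * k \<le> card (V \<inter> ?E `` {u})"
    using G.le_degeneracy_iff[of "12 * k"] by blast
  have fin: "finite V" using V(1) G.finite_verts by (rule finite_subset)
  have "(u, v) \<in> D \<or> (v, u) \<in> D" if "u \<in> V" "v \<in> V" for u v
    using T.one_arc[of u v] that V(1) assms(5) by (auto simp: D_def)
  then obtain x y where xy: "x \<in> V" "y \<in> V"
    and cov: "7 * card (?E \<inter> V \<times> V) \<le> 25 * card ((?E \<inter> V \<times> V) \<inter> (D `` {x, y}) \<times> (D `` {x, y}))"
    using pair_covering_many_arcs[OF fin V(2), of "?E \<inter> V \<times> V" D] by auto
  define S where "S = V \<inter> D `` {x, y}"
  \<comment> \<open>The arcs inside \<open>V\<close> are counted by their first end.\<close>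
  have "(\<Sum>u\<in>V. 12 * k) \<le> (\<Sum>u\<in>V. card (V \<inter> ?E `` {u}))"
    using deg by (rule sum_mono)
  also have "\<dots> = card (SIGMA u:V. V \<inter> ?E `` {u})"
    using fin by simp
  also have "(SIGMA u:V. V \<inter> ?E `` {u}) = ?E \<inter> V \<times> V" by auto
  finally have "12 * k * card V \<le> card (?E \<inter> V \<times> V)" by (simp add: mult.commute)
  moreover have "(?E \<inter> V \<times> V) \<inter> (D `` {x, y}) \<times> (D `` {x, y}) = ?E \<inter> S \<times> S"
    by (auto simp: S_def)
  with cov have "7 * card (?E \<inter> V \<times> V) \<le> 25 * card (?E \<inter> S \<times> S)"
    by (simp only:)
  \<comment> \<open>\<open>84 = 7 * 12\<close>; the next steps use that it exceeds \<open>25 * 2\<close>.\<close>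
  ultimately have "84 * (k * card V) \<le> 25 * card (?E \<inter> S \<times> S)"
    by linarith
  moreover have "k * card S \<le> k * card V"
    using fin by (intro mult_left_mono card_mono) (auto simp: S_def)
  moreover have "0 < k * card V"
    using V(2) fin assms(1) by (simp add: card_gt_0_iff)
  ultimately have "2 * (k * card S) < card (?E \<inter> S \<times> S)" by linarith
  moreover have "finite S" using fin by (simp add: S_def)
  moreover have "sym ?E" using G.sym_arcs by (simp add: symmetric_def)
  ultimately obtain W where W: "W \<subseteq> S" "W \<noteq> {}" "\<And>u. u \<in> W \<Longrightarrow> k < card (W \<inter> ?E `` {u})"
    using dense_imp_core[of S ?E k] by (auto simp: mult.assoc)
  have "finite W" using W(1) \<open>finite S\<close> finite_subset by blast
  have "irrefl ?E" using G.adj_not_same by (auto simp: irrefl_def)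
  note core = core_delete_two[OF \<open>finite W\<close> W(2,3) \<open>irrefl ?E\<close> assms(1), of x y]
  let ?N = "out_neighbourhood T {x, y}"
  have "?N \<subseteq> verts G"
    using T.adj_in_verts(2) assms(5) by (auto simp: out_neighbourhood_def out_neighbours_def)
  then interpret N: graph "G \<restriction> ?N" by (rule G.graph_induce)
  have sub: "W - {x, y} \<subseteq> ?N"
    using W(1) by (auto simp: S_def D_def out_neighbourhood_def out_neighbours_def)
  have "(W - {x, y}) \<inter> arcs_ends (G \<restriction> ?N) `` {u} = (W - {x, y}) \<inter> ?E `` {u}"
    if "u \<in> W - {x, y}" for u
    using sub that by (auto simp: arcs_ends_conv image_iff)
  then have "int (k - 1) \<le> degeneracy (G \<restriction> ?N)"
    unfolding N.le_degeneracy_iff using sub core by (intro exI[of _ "W - {x, y}"]) auto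
  then show ?thesis
    using xy V(1) assms(1) by (intro bexI[of _ x] bexI[of _ y]) auto
qed

end
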